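(* Let $A$ be a 4-dimensional complex 3-Lie algebra with basis $\{e_1,e_2,e_3,e_4\}$, and let $r=\sum_{i,j}a^{ij}e_i\otimes e_j\in A\otimes A$ be skew-symmetric ($a^{ij}=-a^{ji}$). (a) If the only non-zero bracket of basis elements (up to skew-symmetry) is $[e_1,e_2,e_3]=e_1$, then $[[r,r,r]]=0$ if and only if $$a^{23}(a^{12}a^{34}-a^{13}a^{24}-a^{32}a^{14})=0.$$ (b) If the non-zero brackets of basis elements (up to skew-symmetry) are $[e_2,e_3,e_4]=e_2$ and $[e_1,e_3,e_4]=e_1$, then $[[r,r,r]]=0$ if and only if $$a^{34}(a^{12}a^{34}-a^{32}a^{14}+a^{42}a^{13})=0.$$ (c) If the non-zero brackets of basis elements (up to skew-symmetry) are $[e_2,e_3,e_4]=\alpha e_1+e_2$ and $[e_1,e_3,e_4]=e_2$, where $\alpha\in\mathbb{C}$, $\alpha\neq0$, then $[[r,r,r]]=0$ if and only if $$a^{34}(a^{12}a^{43}+a^{32}a^{14}-a^{42}a^{13})=0.$$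
   Context: A 3-Lie algebra is a vector space $A$ with a trilinear, totally skew-symmetric bracket $[\cdot,\cdot,\cdot]:\otimes^3A\to A$ such that for all $x_1,\dots,x_5\in A$: $[x_1,x_2,[x_3,x_4,x_5]]=[[x_1,x_2,x_3],x_4,x_5]+[x_3,[x_1,x_2,x_4],x_5]+[x_3,x_4,[x_1,x_2,x_5]]$. For $r=\sum_i x_i\otimes y_i\in A\otimes A$, the element $[[r,r,r]]\in\otimes^4A$ is $$[[r,r,r]]=\sum_{i,j,k}\big([x_i,x_j,x_k]\otimes y_i\otimes y_j\otimes y_k+x_i\otimes[y_i,x_j,x_k]\otimes y_j\otimes y_k+x_i\otimes x_j\otimes[y_i,y_j,x_k]\otimes y_k+x_i\otimes x_j\otimes x_k\otimes[y_i,y_j,y_k]\big).$$ The equation $[[r,r,r]]=0$ is called the 3-Lie classical Yang-Baxter equation. *)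

theory Defs
  imports Complex_Main "HOL-Library.Poly_Mapping"
begin

class complex_vector = ab_group_add +
  fixes scaleC :: "complex \<Rightarrow> 'a \<Rightarrow> 'a"  (infixr "*\<^sub>C" 75)
  assumes scaleC_add_right: "c *\<^sub>C (x + y) = c *\<^sub>C x + c *\<^sub>C y"
    and scaleC_add_left: "(c + d) *\<^sub>C x = c *\<^sub>C x + d *\<^sub>C x"
    and scaleC_scaleC: "c *\<^sub>C d *\<^sub>C x = (c * d) *\<^sub>C x"
    and scaleC_one: "1 *\<^sub>C x = x"

global_interpretation complex_vector: vector_space "scaleC :: complex \<Rightarrow> 'a \<Rightarrow> 'a::complex_vector"
  by standard
    (simp_all add: scaleC_add_right scaleC_add_left scaleC_scaleC scaleC_one)

abbreviation clinear :: "('a::complex_vector \<Rightarrow> 'b::complex_vector) \<Rightarrow> bool"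
  where "clinear \<equiv> Vector_Spaces.linear scaleC scaleC"

lemma clinearI:
  assumes "\<And>x y. f (x + y) = f x + f y" "\<And>c x. f (c *\<^sub>C x) = c *\<^sub>C f x"
  shows "clinear f"
  by (simp add: Vector_Spaces.linear_def module_hom_def module_hom_axioms_def assms
      complex_vector.vector_space_axioms complex_vector.module_axioms)

lemma clinear_add: "clinear f \<Longrightarrow> f (x + y) = f x + f y"
  and clinear_scale: "clinear f \<Longrightarrow> f (c *\<^sub>C x) = c *\<^sub>C f x"
  by (simp_all add: Vector_Spaces.linear_def module_hom_def module_hom_axioms_def)

lemma clinear_0: "clinear f \<Longrightarrow> f 0 = 0"
  using clinear_add[of f 0 0] by simp

instantiation complex :: complex_vector
begin

definition scaleC_complex :: "complex \<Rightarrow> complex \<Rightarrow> complex"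
  where "scaleC_complex = (*)"

instance
  by standard (simp_all add: scaleC_complex_def algebra_simps)

end

text \<open>For \<open>'b = complex\<close> this is the free complex vector space on \<open>'a\<close>.\<close>

instantiation poly_mapping :: (type, complex_vector) complex_vector
begin

lift_definition scaleC_poly_mapping :: "complex \<Rightarrow> ('a \<Rightarrow>\<^sub>0 'b) \<Rightarrow> ('a \<Rightarrow>\<^sub>0 'b)"
  is "\<lambda>c f x. c *\<^sub>C f x"
  by (erule rev_finite_subset) (auto simp: complex_vector.scale_zero_right)

instance
  by standard
    (transfer, simp add: scaleC_add_right scaleC_add_left scaleC_scaleC scaleC_one)+

end

text \<open>\<open>A \<otimes> B\<close> is the free vector space on \<open>A \<times> B\<close> modulo the bilinearity relations.\<close>

abbreviation free_gen :: "'a \<Rightarrow> 'b \<Rightarrow> ('a \<times> 'b) \<Rightarrow>\<^sub>0 complex"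
  where "free_gen x y \<equiv> Poly_Mapping.single (x, y) 1"

definition tensor_relations :: "(('a::complex_vector \<times> 'b::complex_vector) \<Rightarrow>\<^sub>0 complex) set"
  where "tensor_relations = complex_vector.span
    ({free_gen (x + x') y - free_gen x y - free_gen x' y | x x' y. True} \<union>
     {free_gen x (y + y') - free_gen x y - free_gen x y' | x y y'. True} \<union>
     {free_gen (c *\<^sub>C x) y - c *\<^sub>C free_gen x y | c x y. True} \<union>
     {free_gen x (c *\<^sub>C y) - c *\<^sub>C free_gen x y | c x y. True})"

lemma tensor_relations_0: "0 \<in> tensor_relations"
  and tensor_relations_add: "p \<in> tensor_relations \<Longrightarrow> q \<in> tensor_relations \<Longrightarrow> p + q \<in> tensor_relations"
  and tensor_relations_scale: "p \<in> tensor_relations \<Longrightarrow> c *\<^sub>C p \<in> tensor_relations"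
  and tensor_relations_neg: "p \<in> tensor_relations \<Longrightarrow> - p \<in> tensor_relations"
  and tensor_relations_diff: "p \<in> tensor_relations \<Longrightarrow> q \<in> tensor_relations \<Longrightarrow> p - q \<in> tensor_relations"
  unfolding tensor_relations_def
  by (auto intro: complex_vector.span_zero complex_vector.span_add complex_vector.span_scale
      complex_vector.span_neg complex_vector.span_diff)

quotient_type (overloaded) ('a, 'b) tensor =
  "('a::complex_vector \<times> 'b::complex_vector) \<Rightarrow>\<^sub>0 complex" / "\<lambda>p q. p - q \<in> tensor_relations"
proof (rule equivpI)
  show "reflp (\<lambda>p q. p - q \<in> (tensor_relations :: (('a \<times> 'b) \<Rightarrow>\<^sub>0 complex) set))"
    by (simp add: reflp_def tensor_relations_0)
  show "symp (\<lambda>p q. p - q \<in> (tensor_relations :: (('a \<times> 'b) \<Rightarrow>\<^sub>0 complex) set))"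
    using tensor_relations_neg by (fastforce simp: symp_def)
  show "transp (\<lambda>p q. p - q \<in> (tensor_relations :: (('a \<times> 'b) \<Rightarrow>\<^sub>0 complex) set))"
    using tensor_relations_add by (fastforce simp: transp_def)
qed

instantiation tensor :: (complex_vector, complex_vector) complex_vector
begin

lift_definition zero_tensor :: "('a, 'b) tensor" is 0 .

lift_definition plus_tensor :: "('a, 'b) tensor \<Rightarrow> ('a, 'b) tensor \<Rightarrow> ('a, 'b) tensor" is "(+)"
  using tensor_relations_add by (fastforce simp: algebra_simps)

lift_definition minus_tensor :: "('a, 'b) tensor \<Rightarrow> ('a, 'b) tensor \<Rightarrow> ('a, 'b) tensor" is "(-)"
  using tensor_relations_diff by (fastforce simp: algebra_simps)

lift_definition uminus_tensor :: "('a, 'b) tensor \<Rightarrow> ('a, 'b) tensor" is uminus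
  using tensor_relations_neg by (fastforce simp: algebra_simps)

lift_definition scaleC_tensor :: "complex \<Rightarrow> ('a, 'b) tensor \<Rightarrow> ('a, 'b) tensor" is scaleC
  using tensor_relations_scale by (fastforce simp: complex_vector.scale_right_diff_distrib)

instance
  by standard
    (transfer, simp add: tensor_relations_0 scaleC_add_right scaleC_add_left scaleC_scaleC
      scaleC_one algebra_simps)+

end

lift_definition tensor_prod :: "'a::complex_vector \<Rightarrow> 'b::complex_vector \<Rightarrow> ('a, 'b) tensor"
  (infixr "\<otimes>" 70) is "\<lambda>x y. free_gen x y" .

lemma tensor_add_left: "(x + x') \<otimes> y = x \<otimes> y + x' \<otimes> y"
  and tensor_add_right: "x \<otimes> (y + y') = x \<otimes> y + x \<otimes> y'"
  and tensor_scale_left: "(c *\<^sub>C x) \<otimes> y = c *\<^sub>C (x \<otimes> y)"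
  and tensor_scale_right: "x \<otimes> (c *\<^sub>C y) = c *\<^sub>C (x \<otimes> y)"
proof -
  show "(x + x') \<otimes> y = x \<otimes> y + x' \<otimes> y"
    by transfer (unfold tensor_relations_def diff_diff_eq[symmetric],
        rule complex_vector.span_base, blast)
  show "x \<otimes> (y + y') = x \<otimes> y + x \<otimes> y'"
    by transfer (unfold tensor_relations_def diff_diff_eq[symmetric],
        rule complex_vector.span_base, blast)
  show "(c *\<^sub>C x) \<otimes> y = c *\<^sub>C (x \<otimes> y)"
    by transfer (unfold tensor_relations_def, rule complex_vector.span_base, blast)
  show "x \<otimes> (c *\<^sub>C y) = c *\<^sub>C (x \<otimes> y)"
    by transfer (unfold tensor_relations_def, rule complex_vector.span_base, blast)
qed

definition cbilinear :: "('a::complex_vector \<Rightarrow> 'b::complex_vector \<Rightarrow> 'c::complex_vector) \<Rightarrow> bool"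
  where "cbilinear f \<longleftrightarrow> (\<forall>x. clinear (f x)) \<and> (\<forall>y. clinear (\<lambda>x. f x y))"

lemma cbilinear_tensor: "cbilinear (\<otimes>)"
  unfolding cbilinear_def
  by (intro conjI allI clinearI tensor_add_left tensor_add_right tensor_scale_left tensor_scale_right)

lemma free_lift_clinear:
  fixes f :: "'k \<Rightarrow> 'c::complex_vector"
  shows "clinear (\<lambda>p. \<Sum>k\<in>Poly_Mapping.keys p. Poly_Mapping.lookup p k *\<^sub>C f k)"
proof -
  have ext: "(\<Sum>k\<in>Poly_Mapping.keys p. Poly_Mapping.lookup p k *\<^sub>C f k) =
      (\<Sum>k\<in>S. Poly_Mapping.lookup p k *\<^sub>C f k)"
    if "finite S" "Poly_Mapping.keys p \<subseteq> S" for p :: "'k \<Rightarrow>\<^sub>0 complex" and S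
    using that by (intro sum.mono_neutral_left) (auto simp: in_keys_iff)
  show ?thesis
  proof (rule clinearI)
    fix p q :: "'k \<Rightarrow>\<^sub>0 complex"
    let ?S = "Poly_Mapping.keys p \<union> Poly_Mapping.keys q"
    have S: "finite ?S" "Poly_Mapping.keys (p + q) \<subseteq> ?S"
      "Poly_Mapping.keys p \<subseteq> ?S" "Poly_Mapping.keys q \<subseteq> ?S"
      by (simp_all add: Poly_Mapping.keys_add)
    show "(\<Sum>k\<in>Poly_Mapping.keys (p + q). Poly_Mapping.lookup (p + q) k *\<^sub>C f k) =
      (\<Sum>k\<in>Poly_Mapping.keys p. Poly_Mapping.lookup p k *\<^sub>C f k) +
      (\<Sum>k\<in>Poly_Mapping.keys q. Poly_Mapping.lookup q k *\<^sub>C f k)"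
      unfolding ext[OF S(1,2)] ext[OF S(1,3)] ext[OF S(1,4)]
      by (simp only: lookup_add scaleC_add_left sum.distrib)
  next
    fix c and p :: "'k \<Rightarrow>\<^sub>0 complex"
    have lk: "Poly_Mapping.lookup (c *\<^sub>C p) k = c * Poly_Mapping.lookup p k" for k
      by transfer (simp add: scaleC_complex_def)
    have "Poly_Mapping.keys (c *\<^sub>C p) \<subseteq> Poly_Mapping.keys p"
      by (rule subsetI) (simp add: lk flip: lookup_not_eq_zero_eq_in_keys)
    then show "(\<Sum>k\<in>Poly_Mapping.keys (c *\<^sub>C p). Poly_Mapping.lookup (c *\<^sub>C p) k *\<^sub>C f k) =
      c *\<^sub>C (\<Sum>k\<in>Poly_Mapping.keys p. Poly_Mapping.lookup p k *\<^sub>C f k)"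
      unfolding complex_vector.scale_sum_right scaleC_scaleC lk[symmetric]
      by (rule ext[OF finite_keys])
  qed
qed

lemma tensor_universal:
  fixes f :: "'a::complex_vector \<Rightarrow> 'b::complex_vector \<Rightarrow> 'c::complex_vector"
  assumes "cbilinear f"
  obtains g :: "('a, 'b) tensor \<Rightarrow> 'c" where "clinear g" "\<And>x y. g (x \<otimes> y) = f x y"
proof -
  define F where "F = (\<lambda>p :: ('a \<times> 'b) \<Rightarrow>\<^sub>0 complex.
    \<Sum>k\<in>Poly_Mapping.keys p. Poly_Mapping.lookup p k *\<^sub>C case_prod f k)"
  have F: "clinear F"
    unfolding F_def by (rule free_lift_clinear)
  have add: "F (p + q) = F p + F q" and scale: "F (c *\<^sub>C p) = c *\<^sub>C F p" for p q c
    using F by (auto simp: clinear_add clinear_scale)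
  have diff: "F (p - q) = F p - F q" for p q
    using add[of "p - q" q] by simp
  have gen: "F (free_gen x y) = f x y" for x y
    by (simp add: F_def scaleC_one)
  have f: "f (x + x') y = f x y + f x' y" "f x (y + y') = f x y + f x y'"
    "f (c *\<^sub>C x) y = c *\<^sub>C f x y" "f x (c *\<^sub>C y) = c *\<^sub>C f x y" for x x' y y' c
    using assms clinear_add[of "f x"] clinear_scale[of "f x"]
      clinear_add[of "\<lambda>x. f x y"] clinear_scale[of "\<lambda>x. f x y"]
    by (auto simp: cbilinear_def)
  have sub: "complex_vector.subspace {p. F p = 0}"
    using add scale clinear_0[OF F] by (auto simp: complex_vector.subspace_def)
  have rel: "F p = 0" if "p \<in> tensor_relations" for p
  proof -
    have "tensor_relations \<subseteq> {p. F p = 0}"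
      unfolding tensor_relations_def
      by (rule complex_vector.span_minimal[OF _ sub]) (auto simp: diff scale gen f)
    then show ?thesis using that by blast
  qed
  define g where "g = (\<lambda>t. F (rep_tensor t))"
  have g: "g (abs_tensor p) = F p" for p
  proof -
    have "abs_tensor (rep_tensor (abs_tensor p)) = abs_tensor p"
      by (rule Quotient3_abs_rep[OF Quotient3_tensor])
    then have "rep_tensor (abs_tensor p) - p \<in> tensor_relations"
      by (simp only: tensor.abs_eq_iff)
    from rel[OF this] show ?thesis by (simp add: g_def diff)
  qed
  have "clinear g"
  proof (rule clinearI)
    show "g (s + t) = g s + g t" for s t
      by (induction s rule: tensor.abs_induct; induction t rule: tensor.abs_induct) (simp add: plus_tensor.abs_eq g add)
    show "g (c *\<^sub>C s) = c *\<^sub>C g s" for c s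
      by (induction s rule: tensor.abs_induct) (simp add: scaleC_tensor.abs_eq g scale)
  qed
  moreover have "g (x \<otimes> y) = f x y" for x y
    by (simp add: tensor_prod.abs_eq g gen)
  ultimately show ?thesis by (rule that)
qed

lemma clinear_sum_list: "clinear g \<Longrightarrow> g (\<Sum>z\<leftarrow>zs. h z) = (\<Sum>z\<leftarrow>zs. g (h z))"
  by (induction zs) (simp_all add: clinear_0 clinear_add)

lemma tensor_representation_cong:
  assumes "cbilinear f" and "(\<Sum>(x, y)\<leftarrow>ps. x \<otimes> y) = (\<Sum>(x, y)\<leftarrow>qs. x \<otimes> y)"
  shows "(\<Sum>(x, y)\<leftarrow>ps. f x y) = (\<Sum>(x, y)\<leftarrow>qs. f x y)"
proof -
  obtain g where g: "clinear g" "\<And>x y. g (x \<otimes> y) = f x y"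
    using tensor_universal[OF assms(1)] by blast
  have "g (\<Sum>(x, y)\<leftarrow>zs. x \<otimes> y) = (\<Sum>(x, y)\<leftarrow>zs. f x y)" for zs
    using clinear_sum_list[OF g(1), of "case_prod (\<otimes>)" zs] by (simp add: g(2) case_prod_unfold)
  then show ?thesis using assms(2) by metis
qed

lemma tensor_representation: "\<exists>ps. t = (\<Sum>(x, y)\<leftarrow>ps. x \<otimes> y)"
proof (induction t rule: tensor.abs_induct)
  case (1 p)
  have gen: "abs_tensor (Poly_Mapping.single k c) = (c *\<^sub>C fst k) \<otimes> snd k" for k :: "'a \<times> 'b" and c
  proof -
    have "Poly_Mapping.single k c = c *\<^sub>C free_gen (fst k) (snd k)"
      by (rule poly_mapping_eqI, transfer) (auto simp: scaleC_complex_def when_def)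
    then show ?thesis
      by (metis tensor_scale_left tensor_prod.abs_eq scaleC_tensor.abs_eq)
  qed
  show ?case
  proof (induction p rule: Poly_Mapping.update_induct)
    case const
    show ?case by (rule exI[of _ "[]"]) (simp add: zero_tensor_def)
  next
    case (update p k c)
    then obtain ps where "abs_tensor p = (\<Sum>(x, y)\<leftarrow>ps. x \<otimes> y)" by blast
    moreover have "Poly_Mapping.update k c p = Poly_Mapping.single k c + p"
    proof (rule poly_mapping_eqI)
      have "Poly_Mapping.lookup p k = 0"
        using update(1) by (metis in_keys_iff)
      then show "Poly_Mapping.lookup (Poly_Mapping.update k c p) k' =
          Poly_Mapping.lookup (Poly_Mapping.single k c + p) k'" for k'
        by (auto simp: lookup_update lookup_add lookup_single)
    qed
    ultimately have "abs_tensor (Poly_Mapping.update k c p) = (\<Sum>(x, y)\<leftarrow>(c *\<^sub>C fst k, snd k) # ps. x \<otimes> y)"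
      using plus_tensor.abs_eq[of "Poly_Mapping.single k c" p] gen[of k c] by simp
    then show ?case by (rule exI)
  qed
qed

locale three_lie_algebra =
  fixes br :: "'a::complex_vector \<Rightarrow> 'a \<Rightarrow> 'a \<Rightarrow> 'a"
  assumes clinear_1: "clinear (\<lambda>x. br x y z)"
    and clinear_2: "clinear (\<lambda>y. br x y z)"
    and clinear_3: "clinear (\<lambda>z. br x y z)"
    and skew_12: "br y x z = - br x y z"
    and skew_23: "br x z y = - br x y z"
    and fundamental_identity:
      "br x1 x2 (br x3 x4 x5) =
        br (br x1 x2 x3) x4 x5 + br x3 (br x1 x2 x4) x5 + br x3 x4 (br x1 x2 x5)"

text \<open>The list \<open>ps\<close> consists of the pairs \<open>(x\<^sub>i, y\<^sub>i)\<close> of a representation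
  \<open>r = \<Sum>\<^sub>i x\<^sub>i \<otimes> y\<^sub>i\<close>.\<close>

definition rrr_of_representation ::
  "('a::complex_vector \<Rightarrow> 'a \<Rightarrow> 'a \<Rightarrow> 'a) \<Rightarrow> ('a \<times> 'a) list \<Rightarrow>
    ('a, ('a, ('a, 'a) tensor) tensor) tensor"
  where "rrr_of_representation br ps =
    (\<Sum>(xi, yi)\<leftarrow>ps. \<Sum>(xj, yj)\<leftarrow>ps. \<Sum>(xk, yk)\<leftarrow>ps.
      br xi xj xk \<otimes> yi \<otimes> yj \<otimes> yk + xi \<otimes> br yi xj xk \<otimes> yj \<otimes> yk +
      xi \<otimes> xj \<otimes> br yi yj xk \<otimes> yk + xi \<otimes> xj \<otimes> xk \<otimes> br yi yj yk)"

text \<open>\<open>rrr br r\<close> is \<open>[[r,r,r]]\<close>. The choice of a representation of \<open>r\<close> is immaterial,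
  see \<open>rrr_eq\<close> below.\<close>

definition rrr ::
  "('a::complex_vector \<Rightarrow> 'a \<Rightarrow> 'a \<Rightarrow> 'a) \<Rightarrow> ('a, 'a) tensor \<Rightarrow>
    ('a, ('a, ('a, 'a) tensor) tensor) tensor"
  where "rrr br r = rrr_of_representation br (SOME ps. r = (\<Sum>(x, y)\<leftarrow>ps. x \<otimes> y))"

lemma clinear_sum_list_fun:
  "(\<And>z. z \<in> set zs \<Longrightarrow> clinear (h z)) \<Longrightarrow> clinear (\<lambda>x. \<Sum>z\<leftarrow>zs. h z x)"
  by (rule clinearI; induction zs)
    (simp_all add: clinear_add clinear_scale complex_vector.scale_zero_right scaleC_add_right
      algebra_simps)

lemma cbilinear_sum_list_fun:
  assumes "\<And>u v. cbilinear (\<lambda>x y. h u v x y)"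
  shows "cbilinear (\<lambda>x y. \<Sum>(u, v)\<leftarrow>zs. h u v x y)"
  using assms unfolding cbilinear_def
  by (auto simp: case_prod_unfold intro!: clinear_sum_list_fun)

context three_lie_algebra
begin

lemma rrr_of_representation_cong:
  assumes eq: "(\<Sum>(x, y)\<leftarrow>ps. x \<otimes> y) = (\<Sum>(x, y)\<leftarrow>qs. x \<otimes> y)"
  shows "rrr_of_representation br ps = rrr_of_representation br qs"
proof -
  define Q where "Q = (\<lambda>xi yi xj yj xk yk.
      br xi xj xk \<otimes> yi \<otimes> yj \<otimes> yk + xi \<otimes> br yi xj xk \<otimes> yj \<otimes> yk +
      xi \<otimes> xj \<otimes> br yi yj xk \<otimes> yk + xi \<otimes> xj \<otimes> xk \<otimes> br yi yj yk)"
  note lin =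
    clinear_add[OF clinear_1] clinear_add[OF clinear_2] clinear_add[OF clinear_3]
    clinear_scale[OF clinear_1] clinear_scale[OF clinear_2] clinear_scale[OF clinear_3]
    tensor_add_left tensor_add_right tensor_scale_left tensor_scale_right scaleC_add_right
  have Q1: "cbilinear (\<lambda>x y. Q x y x2 y2 x3 y3)"
    and Q2: "cbilinear (\<lambda>x y. Q x1 y1 x y x3 y3)"
    and Q3: "cbilinear (\<lambda>x y. Q x1 y1 x2 y2 x y)" for x1 y1 x2 y2 x3 y3
    unfolding Q_def cbilinear_def by (intro conjI allI clinearI; simp add: lin)+
  have Q23: "cbilinear (\<lambda>x y. \<Sum>(u, v)\<leftarrow>qs. Q x1 y1 x y u v)" for x1 y1
    by (rule cbilinear_sum_list_fun) (rule Q2)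
  have Q123: "cbilinear (\<lambda>x y. \<Sum>(u', v')\<leftarrow>qs. \<Sum>(u, v)\<leftarrow>qs. Q x y u' v' u v)"
    by (intro cbilinear_sum_list_fun) (rule Q1)
  have "rrr_of_representation br ps =
      (\<Sum>(x1, y1)\<leftarrow>ps. \<Sum>(x2, y2)\<leftarrow>ps. \<Sum>(x3, y3)\<leftarrow>ps. Q x1 y1 x2 y2 x3 y3)"
    by (simp add: rrr_of_representation_def Q_def)
  also have "\<dots> = (\<Sum>(x1, y1)\<leftarrow>qs. \<Sum>(x2, y2)\<leftarrow>qs. \<Sum>(x3, y3)\<leftarrow>qs. Q x1 y1 x2 y2 x3 y3)"
    by (simp only: tensor_representation_cong[OF Q3 eq] tensor_representation_cong[OF Q23 eq]
        tensor_representation_cong[OF Q123 eq])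
  also have "\<dots> = rrr_of_representation br qs"
    by (simp add: rrr_of_representation_def Q_def)
  finally show ?thesis .
qed

theorem rrr_eq:
  assumes "r = (\<Sum>(x, y)\<leftarrow>ps. x \<otimes> y)"
  shows "rrr br r = rrr_of_representation br ps"
  unfolding rrr_def
  by (rule rrr_of_representation_cong, rule someI2_ex[OF tensor_representation])
    (use assms in simp)

end

end

(*
  Contracting [[r,r,r]] with the dual basis gives, with f_q = \<Sum>_i a^{iq} e_i and T(p;q,s,t) the
  e_p-coordinate of [f_q, f_s, f_t], the components
    R(p,q,s,t) = T(p;q,s,t) - T(q;p,s,t) + T(s;p,q,t) - T(t;p,q,s),
  the signs coming from the skew-symmetry of r. Since T alternates in its last three arguments, R is
  totally skew-symmetric, so in dimension 4 the equation [[r,r,r]] = 0 amounts to R(1,2,3,4) = 0.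
  For the three brackets, R(1,2,3,4) is 1, 2 and -1 times the stated polynomial.
*)

theory Submission
  imports Defs
begin

section \<open>Linear maps and contraction of tensors\<close>

lemma clinear_sum: "clinear f \<Longrightarrow> f (\<Sum>i\<in>I. g i) = (\<Sum>i\<in>I. f (g i))"
  by (induction I rule: infinite_finite_induct) (simp_all add: clinear_0 clinear_add)

lemma clinear_minus: "clinear f \<Longrightarrow> f (- x) = - f x"
  by (metis add.right_inverse add_eq_0_iff clinear_0 clinear_add)

lemma clinear_compose: "clinear f \<Longrightarrow> clinear g \<Longrightarrow> clinear (\<lambda>x. g (f x))"
  by (rule clinearI) (simp_all add: clinear_add clinear_scale)

lemma clinear_tensor_left: "clinear (\<lambda>x. x \<otimes> y)"
  and clinear_tensor_right: "clinear (\<lambda>y. x \<otimes> y)"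
  using cbilinear_tensor unfolding cbilinear_def by blast+

lemmas tensor_sum_left = clinear_sum[OF clinear_tensor_left]
  and tensor_sum_right = clinear_sum[OF clinear_tensor_right]

text \<open>This is \<open>f\<close> tensored with the identity. For linear \<open>f\<close> the
  universal property supplies such a map, and it is unique because pure tensors span.\<close>

definition contract ::
  "('a::complex_vector \<Rightarrow> complex) \<Rightarrow> ('a, 'b::complex_vector) tensor \<Rightarrow> 'b"
  where "contract f = (SOME g. clinear g \<and> (\<forall>x y. g (x \<otimes> y) = f x *\<^sub>C y))"

lemma
  fixes f :: "'a::complex_vector \<Rightarrow> complex" and y :: "'b::complex_vector"
  assumes "clinear f"
  shows clinear_contract: "clinear (contract f :: ('a, 'b) tensor \<Rightarrow> 'b)"
    and contract_tensor_prod: "contract f (x \<otimes> y) = f x *\<^sub>C y"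
proof -
  have "cbilinear (\<lambda>x (y :: 'b). f x *\<^sub>C y)"
    unfolding cbilinear_def using assms
    by (intro conjI allI clinearI)
      (simp_all add: clinear_add clinear_scale scaleC_add_right scaleC_add_left scaleC_scaleC
        scaleC_complex_def mult.commute)
  from tensor_universal[OF this]
  have "\<exists>g :: ('a, 'b) tensor \<Rightarrow> 'b. clinear g \<and> (\<forall>x y. g (x \<otimes> y) = f x *\<^sub>C y)"
    by metis
  from someI_ex[OF this, folded contract_def]
  show "clinear (contract f :: ('a, 'b) tensor \<Rightarrow> 'b)" "contract f (x \<otimes> y) = f x *\<^sub>C y"
    by simp_all
qed

text \<open>Both sides are linear in \<open>t\<close> and every tensor is a sum of pure ones; on
  \<open>x \<otimes> y\<close> the scalars \<open>c i x\<close> move across the tensor sign.\<close>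

lemma tensor_expand:
  assumes lin: "\<And>i. i \<in> I \<Longrightarrow> clinear (c i)"
    and expand: "\<And>x. (\<Sum>i\<in>I. c i x *\<^sub>C e i) = x"
  shows "(\<Sum>i\<in>I. e i \<otimes> contract (c i) t) = t"
proof -
  have one: "(\<Sum>i\<in>I. e i \<otimes> contract (c i) (x \<otimes> y)) = x \<otimes> y" for x and y :: 'c
  proof -
    have "(\<Sum>i\<in>I. e i \<otimes> contract (c i) (x \<otimes> y)) = (\<Sum>i\<in>I. c i x *\<^sub>C e i) \<otimes> y"
      unfolding tensor_sum_left
      by (intro sum.cong) (simp_all add: contract_tensor_prod lin tensor_scale_left tensor_scale_right)
    then show ?thesis by (simp add: expand)
  qed
  have linear: "clinear (\<lambda>t :: ('b, 'c) tensor. \<Sum>i\<in>I. e i \<otimes> contract (c i) t)"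
    by (rule clinearI)
      (auto simp: clinear_add[OF clinear_contract] clinear_scale[OF clinear_contract] lin
        tensor_add_right tensor_scale_right complex_vector.scale_sum_right
        simp flip: sum.distrib intro!: sum.cong)
  obtain ps where t: "t = (\<Sum>(x, y)\<leftarrow>ps. x \<otimes> y)"
    using tensor_representation by blast
  show ?thesis
    unfolding t clinear_sum_list[OF linear] by (simp add: case_prod_unfold one)
qed

text \<open>Replaces a basis of the tensor product. The second factor is arbitrary, so the criterion
  can be iterated over nested tensors.\<close>

lemma contract_eq_0:
  assumes "\<And>i. i \<in> I \<Longrightarrow> clinear (c i)" "\<And>x. (\<Sum>i\<in>I. c i x *\<^sub>C e i) = x"
    and "\<And>i. i \<in> I \<Longrightarrow> contract (c i) t = 0"
  shows "t = 0"
  using tensor_expand[of I c e t] assms by (simp add: clinear_0[OF clinear_tensor_right])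

section \<open>Coordinates relative to a finite basis\<close>

locale three_lie_algebra_basis = three_lie_algebra br
  for br :: "'a::complex_vector \<Rightarrow> 'a \<Rightarrow> 'a \<Rightarrow> 'a" +
  fixes e :: "'i \<Rightarrow> 'a" and I :: "'i set"
  assumes finite_I: "finite I"
    and inj: "inj_on e I"
    and indep: "complex_vector.independent (e ` I)"
    and span: "complex_vector.span (e ` I) = UNIV"
begin

definition coord :: "'i \<Rightarrow> 'a \<Rightarrow> complex"
  where "coord i x = complex_vector.representation (e ` I) x (e i)"

lemma clinear_coord: "clinear (coord i)"
  unfolding coord_def using indep span
  by (intro clinearI)
    (simp_all add: complex_vector.representation_add complex_vector.representation_scale
      scaleC_complex_def)

lemmas coord_add = clinear_add[OF clinear_coord]
  and coord_scale = clinear_scale[OF clinear_coord]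
  and coord_minus = clinear_minus[OF clinear_coord]
  and coord_0 = clinear_0[OF clinear_coord]

lemma coord_diff: "coord i (x - y) = coord i x - coord i y"
  using coord_add[of i x "- y"] by (simp add: coord_minus)

lemma coord_basis: "i \<in> I \<Longrightarrow> j \<in> I \<Longrightarrow> coord i (e j) = (if i = j then 1 else 0)"
  unfolding coord_def using indep inj
  by (auto simp: complex_vector.representation_basis inj_on_eq_iff)

lemma coord_combination:
  "p \<in> I \<Longrightarrow> coord p (\<Sum>i\<in>I. f i *\<^sub>C e i) = f p"
  using finite_I
  by (simp add: clinear_sum[OF clinear_coord] coord_scale coord_basis scaleC_complex_def
      if_distrib sum.delta cong: if_cong)

lemma coord_expand: "(\<Sum>i\<in>I. coord i x *\<^sub>C e i) = x"
  using complex_vector.sum_representation_eq[of "e ` I" x "e ` I"] indep span finite_I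
  by (simp add: coord_def sum.reindex[OF inj])

text \<open>For indices in \<open>I\<close> this is the coefficient at
  \<open>e p \<otimes> e q \<otimes> e s \<otimes> e t\<close>; the first factor is contracted first
  because tensors nest to the right.\<close>

definition coord4 :: "'i \<Rightarrow> 'i \<Rightarrow> 'i \<Rightarrow> 'i \<Rightarrow> ('a, ('a, ('a, 'a) tensor) tensor) tensor \<Rightarrow> complex"
  where "coord4 p q s t u =
    coord t (contract (coord s) (contract (coord q) (contract (coord p) u)))"

lemma clinear_coord4: "clinear (coord4 p q s t)"
  unfolding coord4_def[abs_def]
  by (rule clinear_compose[OF clinear_contract[OF clinear_coord]])+ (rule clinear_coord)

lemma coord4_tensor_prod:
  "coord4 p q s t (x \<otimes> y \<otimes> z \<otimes> w) = coord p x * coord q y * coord s z * coord t w"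
  by (simp add: coord4_def contract_tensor_prod[OF clinear_coord]
      clinear_scale[OF clinear_contract[OF clinear_coord]] coord_scale scaleC_complex_def)

text \<open>Strip off three factors with \<open>contract_eq_0\<close>; what remains is a vector with
  vanishing coordinates.\<close>

lemma coord4_eq_0:
  assumes "\<And>p q s t. p \<in> I \<Longrightarrow> q \<in> I \<Longrightarrow> s \<in> I \<Longrightarrow> t \<in> I \<Longrightarrow> coord4 p q s t u = 0"
  shows "u = 0"
proof -
  have coord_eq_0: "x = 0" if "\<And>i. i \<in> I \<Longrightarrow> coord i x = 0" for x
    using coord_expand[of x] that by simp
  show ?thesis
    by (intro contract_eq_0[of I coord, OF clinear_coord coord_expand] coord_eq_0)
      (use assms in \<open>simp add: coord4_def\<close>)
qed

section \<open>The bracket and [[r,r,r]] in coordinates\<close>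

lemma br_sum:
  "br (\<Sum>i\<in>J. f i *\<^sub>C x i) y z = (\<Sum>i\<in>J. f i *\<^sub>C br (x i) y z)"
  "br y (\<Sum>i\<in>J. f i *\<^sub>C x i) z = (\<Sum>i\<in>J. f i *\<^sub>C br y (x i) z)"
  "br y z (\<Sum>i\<in>J. f i *\<^sub>C x i) = (\<Sum>i\<in>J. f i *\<^sub>C br y z (x i))"
  by (simp_all add: clinear_sum[OF clinear_1] clinear_sum[OF clinear_2] clinear_sum[OF clinear_3]
      clinear_scale[OF clinear_1] clinear_scale[OF clinear_2] clinear_scale[OF clinear_3])

lemma br_minus: "br (- x) y z = - br x y z" "br x (- y) z = - br x y z" "br x y (- z) = - br x y z"
  by (simp_all add: clinear_minus[OF clinear_1] clinear_minus[OF clinear_2] clinear_minus[OF clinear_3])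

text \<open>A distinct enumeration of \<open>I\<close> turns the list sums of \<open>rrr_eq\<close>
  into sums over a set.\<close>

lemma rrr_sum:
  assumes "r = (\<Sum>i\<in>I. x i \<otimes> y i)"
  shows "rrr br r = (\<Sum>i\<in>I. \<Sum>j\<in>I. \<Sum>k\<in>I.
      br (x i) (x j) (x k) \<otimes> y i \<otimes> y j \<otimes> y k + x i \<otimes> br (y i) (x j) (x k) \<otimes> y j \<otimes> y k +
      x i \<otimes> x j \<otimes> br (y i) (y j) (x k) \<otimes> y k + x i \<otimes> x j \<otimes> x k \<otimes> br (y i) (y j) (y k))"
proof -
  obtain js where "set js = I" "distinct js"
    using finite_distinct_list[OF finite_I] by blast
  then have list: "(\<Sum>i\<leftarrow>js. h i) = (\<Sum>i\<in>I. h i)" for h :: "'i \<Rightarrow> 'b::comm_monoid_add"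
    by (simp add: sum_list_distinct_conv_sum_set)
  have "r = (\<Sum>(x, y)\<leftarrow>map (\<lambda>i. (x i, y i)) js. x \<otimes> y)"
    by (simp add: o_def list assms)
  from rrr_eq[OF this] show ?thesis
    by (simp add: rrr_of_representation_def o_def list)
qed

lemma coord4_rrr:
  assumes r: "r = (\<Sum>i\<in>I. \<Sum>j\<in>I. a i j *\<^sub>C (e i \<otimes> e j))"
    and skew: "\<And>i j. i \<in> I \<Longrightarrow> j \<in> I \<Longrightarrow> a i j = - a j i"
    and I: "p \<in> I" "q \<in> I" "s \<in> I" "t \<in> I"
  defines "f \<equiv> \<lambda>q. \<Sum>i\<in>I. a i q *\<^sub>C e i"
  shows "coord4 p q s t (rrr br r) =
    coord p (br (f q) (f s) (f t)) - coord q (br (f p) (f s) (f t)) +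
    coord s (br (f p) (f q) (f t)) - coord t (br (f p) (f q) (f s))"
proof -
  \<comment> \<open>\<open>b\<close> collects the rows of the matrix \<open>a\<close>,
    \<open>f\<close> its columns; skew-symmetry makes them negatives of each other.\<close>
  define b where "b = (\<lambda>i. \<Sum>j\<in>I. a i j *\<^sub>C e j)"
  have b: "b i = - f i" if "i \<in> I" for i
    unfolding b_def f_def sum_negf[symmetric]
    by (intro sum.cong refl) (metis skew that complex_vector.scale_minus_left)
  have coord_b: "coord q (b i) = a i q" if "q \<in> I" for q i
    using that by (simp add: b_def coord_combination)
  have "r = (\<Sum>i\<in>I. e i \<otimes> b i)"
    by (simp add: r b_def tensor_sum_right tensor_scale_right)
  note rrr = rrr_sum[OF this]
  \<comment> \<open>Expansions for three, two and one columns. They are unfolded in this order,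
    since the later patterns also match brackets with more columns.\<close>
  have f: "coord l (br (f q) (f s) (f t)) =
      (\<Sum>i\<in>I. \<Sum>j\<in>I. \<Sum>k\<in>I. coord l (br (e i) (e j) (e k)) * a i q * a j s * a k t)"
    "coord l (br u (f s) (f t)) =
      (\<Sum>j\<in>I. \<Sum>k\<in>I. coord l (br u (e j) (e k)) * a j s * a k t)"
    "coord l (br u v (f t)) = (\<Sum>k\<in>I. coord l (br u v (e k)) * a k t)" for l q s t u v
    unfolding f_def unfolding br_sum(1) unfolding br_sum(2) unfolding br_sum(3)
    unfolding clinear_sum[OF clinear_coord] coord_scale scaleC_complex_def sum_distrib_left
    by (intro sum.cong refl; simp add: ac_simps)+
  have sum_if: "(\<Sum>i\<in>I. if P then h i else 0) = (if P then \<Sum>i\<in>I. h i else 0)"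
    for P and h :: "'i \<Rightarrow> complex"
    by simp
  \<comment> \<open>In each term an \<open>e\<close> outside the bracket fixes its index, so its
    partner inside becomes a row \<open>b p\<close>, \<open>b q\<close> or \<open>b s\<close>; a
    \<open>b\<close> outside contributes an entry of \<open>a\<close>, with which its partner
    \<open>e\<close> inside sums up to a column \<open>f\<close>.\<close>
  have "coord4 p q s t (rrr br r) =
    coord p (br (f q) (f s) (f t)) + coord q (br (b p) (f s) (f t)) +
    coord s (br (b p) (b q) (f t)) + coord t (br (b p) (b q) (b s))"
    using I finite_I
    unfolding rrr clinear_sum[OF clinear_coord4] clinear_add[OF clinear_coord4] coord4_tensor_prod
    unfolding f(1) unfolding f(2) unfolding f(3)
    by (simp add: sum_if coord_b coord_basis sum.distrib if_distrib[of "\<lambda>x. x * _"] sum.delta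
      flip: sum_distrib_left cong: if_cong)
  \<comment> \<open>The four terms contain 0, 1, 2 and 3 rows, hence the alternating signs.\<close>
  then show ?thesis
    using I by (simp add: b br_minus coord_minus)
qed

text \<open>Skew-symmetry gives u = -u, and 2 is an invertible scalar.\<close>

lemma br_eq_0: "br x x y = 0" "br x y y = 0" "br x y x = 0"
proof -
  have zero: "u = 0" if "u = - u" for u :: 'a
  proof -
    have "2 *\<^sub>C u = u + u" by (metis one_add_one scaleC_add_left scaleC_one)
    also have "\<dots> = 0" using that by (metis add.right_inverse)
    finally show ?thesis by (simp add: complex_vector.scale_eq_0_iff)
  qed
  show "br x x y = 0" for x y using zero skew_12 by blast
  show "br x y y = 0" using zero skew_23 by blast
  show "br x y x = 0" using skew_23[of x x y] \<open>br x x y = 0\<close> by simp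
qed

lemma coord_br_sum:
  "coord l (br (\<Sum>i\<in>I. x i *\<^sub>C e i) (\<Sum>i\<in>I. y i *\<^sub>C e i) (\<Sum>i\<in>I. z i *\<^sub>C e i)) =
    (\<Sum>i\<in>I. \<Sum>j\<in>I. \<Sum>k\<in>I. coord l (br (e i) (e j) (e k)) * x i * y j * z k)"
  unfolding br_sum(1) unfolding br_sum(2) unfolding br_sum(3)
  unfolding clinear_sum[OF clinear_coord] coord_scale scaleC_complex_def sum_distrib_left
  by (intro sum.cong refl) (simp add: ac_simps)

end

text \<open>A tuple either repeats an index, which forces zero, or is a rearrangement of 1, 2, 3, 4,
  reached by adjacent transpositions.\<close>

lemma alternating4_eq_0_iff:
  fixes R :: "nat \<Rightarrow> nat \<Rightarrow> nat \<Rightarrow> nat \<Rightarrow> complex"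
  assumes swap: "\<And>p q s t. R q p s t = - R p q s t" "\<And>p q s t. R p s q t = - R p q s t"
    "\<And>p q s t. R p q t s = - R p q s t"
  shows "(\<forall>p\<in>{1..4}. \<forall>q\<in>{1..4}. \<forall>s\<in>{1..4}. \<forall>t\<in>{1..4}. R p q s t = 0) \<longleftrightarrow>
    R 1 2 3 4 = 0"
proof -
  have "R p q s t = 0" if "R 1 2 3 4 = 0" "p \<in> {1..4}" "q \<in> {1..4}" "s \<in> {1..4}" "t \<in> {1..4}"
    for p q s t
  proof -
    have diag: "R p p s t = 0" "R p q q t = 0" "R p q s s = 0" for p q s t
      using swap(1)[of p p s t] swap(2)[of p q q t] swap(3)[of p q s s] by simp_all
    \<comment> \<open>Speaking of vanishing only avoids signs. As permutative rewrite rules these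
      sort the indices and bring repeated ones together for \<open>diag\<close>.\<close>
    have perm: "R q p s t = 0 \<longleftrightarrow> R p q s t = 0" "R p s q t = 0 \<longleftrightarrow> R p q s t = 0"
      "R p q t s = 0 \<longleftrightarrow> R p q s t = 0" for p q s t
      using swap(1)[of q p s t] swap(2)[of p s q t] swap(3)[of p q t s] by simp_all
    have I: "{1..4::nat} = {1, 2, 3, 4}" by auto
    show ?thesis
      using that unfolding I by (elim insertE emptyE; simp add: diag perm)
  qed
  then show ?thesis by auto
qed

section \<open>The four-dimensional algebras\<close>

theorem theorem3p8:
  fixes br :: "'a::complex_vector \<Rightarrow> 'a \<Rightarrow> 'a \<Rightarrow> 'a"
    and e :: "nat \<Rightarrow> 'a"
    and a :: "nat \<Rightarrow> nat \<Rightarrow> complex"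
    and r :: "('a, 'a) tensor"
  assumes lie: "three_lie_algebra br"
    and basis_inj: "inj_on e {1..4}"
    and basis_indep: "complex_vector.independent (e ` {1..4})"
    and basis_span: "complex_vector.span (e ` {1..4}) = UNIV"
    and r: "r = (\<Sum>i\<in>{1..4}. \<Sum>j\<in>{1..4}. a i j *\<^sub>C (e i \<otimes> e j))"
    and skew: "\<And>i j. i \<in> {1..4} \<Longrightarrow> j \<in> {1..4} \<Longrightarrow> a i j = - a j i"
  shows
    "(br (e 1) (e 2) (e 3) = e 1 \<and> br (e 1) (e 2) (e 4) = 0 \<and>
      br (e 1) (e 3) (e 4) = 0 \<and> br (e 2) (e 3) (e 4) = 0 \<longrightarrow>
        (rrr br r = 0 \<longleftrightarrow>
          a 2 3 * (a 1 2 * a 3 4 - a 1 3 * a 2 4 - a 3 2 * a 1 4) = 0)) \<and>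
     (br (e 2) (e 3) (e 4) = e 2 \<and> br (e 1) (e 3) (e 4) = e 1 \<and>
      br (e 1) (e 2) (e 3) = 0 \<and> br (e 1) (e 2) (e 4) = 0 \<longrightarrow>
        (rrr br r = 0 \<longleftrightarrow>
          a 3 4 * (a 1 2 * a 3 4 - a 3 2 * a 1 4 + a 4 2 * a 1 3) = 0)) \<and>
     (\<forall>\<alpha>. \<alpha> \<noteq> 0 \<and>
      br (e 2) (e 3) (e 4) = \<alpha> *\<^sub>C e 1 + e 2 \<and> br (e 1) (e 3) (e 4) = e 2 \<and>
      br (e 1) (e 2) (e 3) = 0 \<and> br (e 1) (e 2) (e 4) = 0 \<longrightarrow>
        (rrr br r = 0 \<longleftrightarrow>
          a 3 4 * (a 1 2 * a 4 3 + a 3 2 * a 1 4 - a 4 2 * a 1 3) = 0))"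
proof -
  interpret three_lie_algebra_basis br e "{1..4}"
    using lie basis_inj basis_indep basis_span
    by (simp add: three_lie_algebra_basis_def three_lie_algebra_basis_axioms_def)
  define f where "f = (\<lambda>q. \<Sum>i\<in>{1..4}. a i q *\<^sub>C e i)"
  define R where "R = (\<lambda>p q s t.
    coord p (br (f q) (f s) (f t)) - coord q (br (f p) (f s) (f t)) +
    coord s (br (f p) (f q) (f t)) - coord t (br (f p) (f q) (f s)))"
  have coord4: "coord4 p q s t (rrr br r) = R p q s t"
    if "p \<in> {1..4}" "q \<in> {1..4}" "s \<in> {1..4}" "t \<in> {1..4}" for p q s t
    unfolding R_def f_def using that by (intro coord4_rrr r skew)
  have "rrr br r = 0 \<longleftrightarrow>
      (\<forall>p\<in>{1..4}. \<forall>q\<in>{1..4}. \<forall>s\<in>{1..4}. \<forall>t\<in>{1..4}. R p q s t = 0)"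
    by (metis coord4 coord4_eq_0 clinear_0[OF clinear_coord4])
  also have "\<dots> \<longleftrightarrow> R 1 2 3 4 = 0"
  proof (rule alternating4_eq_0_iff)
    fix p q s t
    \<comment> \<open>Each adjacent swap exchanges two terms of \<open>R\<close> that carry opposite
      signs and swaps bracket arguments in the other two. \<open>1\<close> stays folded because
      \<open>coord\<close> carries the index set \<open>{1..4}\<close>.\<close>
    show "R q p s t = - R p q s t"
      by (simp add: R_def skew_12[of "f q" "f p"] coord_minus del: One_nat_def)
    show "R p s q t = - R p q s t"
      by (simp add: R_def skew_12[of "f s" "f q"] skew_23[of _ "f q" "f s"] coord_minus del: One_nat_def)
    show "R p q t s = - R p q s t"
      by (simp add: R_def skew_23[of _ "f s" "f t"] coord_minus del: One_nat_def)
  qed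
  finally have rrr: "rrr br r = 0 \<longleftrightarrow> R 1 2 3 4 = 0" .

  have sum4: "(\<Sum>i\<in>{1..4}. h i) = h 1 + h 2 + h 3 + h 4" for h :: "nat \<Rightarrow> complex"
    by (simp add: numeral_eq_Suc)
  have a: "a 1 1 = 0" "a 2 2 = 0" "a 3 3 = 0" "a 4 4 = 0"
    "a 2 1 = - a 1 2" "a 3 1 = - a 1 3" "a 4 1 = - a 1 4"
    "a 3 2 = - a 2 3" "a 4 2 = - a 2 4" "a 4 3 = - a 3 4"
    using skew[of 1 1] skew[of 2 2] skew[of 3 3] skew[of 4 4]
      skew[of 2 1] skew[of 3 1] skew[of 4 1] skew[of 3 2] skew[of 4 2] skew[of 4 3] by simp_all
  have br_perm: "br y x z = - br x y z" "br x z y = - br x y z" "br y z x = br x y z"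
      "br z x y = br x y z" "br z y x = - br x y z" for x y z
    by (simp_all add: skew_12[of y x] skew_12[of z x] skew_12[of z y] skew_23[of x z y]
      skew_23[of y z x] br_minus)
  \<comment> \<open>Only increasing triples are instantiated, so rewriting sorts the basis vectors
    in a bracket and cannot loop.\<close>
  note perms = br_perm[where x = "e 1" and y = "e 2" and z = "e 3"] br_perm[where x = "e 1" and y = "e 2" and z = "e 4"]
    br_perm[where x = "e 1" and y = "e 3" and z = "e 4"] br_perm[where x = "e 2" and y = "e 3" and z = "e 4"]
  note R_simps = R_def f_def coord_br_sum sum4 perms br_eq_0 coord_basis coord_minus coord_0
    coord_add coord_diff coord_scale scaleC_complex_def a

  show ?thesis
  proof (intro conjI allI impI)
    assume *: "br (e 1) (e 2) (e 3) = e 1 \<and> br (e 1) (e 2) (e 4) = 0 \<and>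
      br (e 1) (e 3) (e 4) = 0 \<and> br (e 2) (e 3) (e 4) = 0"
    \<comment> \<open>Brackets are multiples of \<open>e 1\<close>, so only the first term of
      \<open>R\<close> survives: the minor of \<open>a\<close> with rows 1, 2, 3 and columns 2, 3,
      4.\<close>
    have "R 1 2 3 4 = a 2 3 * (a 1 2 * a 3 4 - a 1 3 * a 2 4 - a 3 2 * a 1 4)"
      using * by (simp add: R_simps del: One_nat_def) (simp add: algebra_simps)
    then show "rrr br r = 0 \<longleftrightarrow>
        a 2 3 * (a 1 2 * a 3 4 - a 1 3 * a 2 4 - a 3 2 * a 1 4) = 0"
      by (simp only: rrr)
  next
    assume *: "br (e 2) (e 3) (e 4) = e 2 \<and> br (e 1) (e 3) (e 4) = e 1 \<and>
      br (e 1) (e 2) (e 3) = 0 \<and> br (e 1) (e 2) (e 4) = 0"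
    \<comment> \<open>The \<open>e 1\<close> and \<open>e 2\<close> terms of \<open>R\<close> each
      contribute the stated polynomial, hence the factor 2.\<close>
    have "R 1 2 3 4 = 2 * (a 3 4 * (a 1 2 * a 3 4 - a 3 2 * a 1 4 + a 4 2 * a 1 3))"
      using * by (simp add: R_simps del: One_nat_def) (simp add: algebra_simps)
    then show "rrr br r = 0 \<longleftrightarrow>
        a 3 4 * (a 1 2 * a 3 4 - a 3 2 * a 1 4 + a 4 2 * a 1 3) = 0"
      by (simp add: rrr)
  next
    fix \<alpha>
    assume *: "\<alpha> \<noteq> 0 \<and>
      br (e 2) (e 3) (e 4) = \<alpha> *\<^sub>C e 1 + e 2 \<and> br (e 1) (e 3) (e 4) = e 2 \<and>
      br (e 1) (e 2) (e 3) = 0 \<and> br (e 1) (e 2) (e 4) = 0"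
    \<comment> \<open>\<open>\<alpha>\<close> occurs only as a factor of the principal minor on 2,
      3, 4, which vanishes as a skew-symmetric determinant of odd size. The principal minor on 1, 3,
      4 drops out likewise.\<close>
    have "R 1 2 3 4 = - (a 3 4 * (a 1 2 * a 4 3 + a 3 2 * a 1 4 - a 4 2 * a 1 3))"
      using * by (simp add: R_simps del: One_nat_def) (simp add: algebra_simps)
    then show "rrr br r = 0 \<longleftrightarrow>
        a 3 4 * (a 1 2 * a 4 3 + a 3 2 * a 1 4 - a 4 2 * a 1 3) = 0"
      by (simp add: rrr)
  qed
qed

end
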